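(* Let $b\ge3$ be an integer and let $$\alpha_b=\frac{\log b-\log\big(4+\log(\frac b2-1)\big)}{2\log b}.$$ Then, for positive integers $l$ and $x=b^{2l}$, we have $$\int_0^1|\tilde\Phi_l(t)|\,dt\ll\frac1{x^{\alpha_b}}\quad\text{and}\quad\int_0^1|\tilde\Phi_l'(t)|\,dt\ll l\,x^{1-\alpha_b}.$$ In particular, for every $b\ge1100$ there is some $\delta_b>0$ such that $$\int_0^1|\tilde\Phi_l(t)|\,dt\ll\frac1{x^{\frac13+\delta_b}}\quad\text{and}\quad\int_0^1|\tilde\Phi_l'(t)|\,dt\ll x^{\frac23-\delta_b}.$$
   Context: Write $\mathrm{e}(z)=e^{2\pi iz}$. For a fixed integer base $b$, let $f_1(t)=\sum_{0\le n<b}\mathrm{e}(nt)$, and for integers $l\ge 2$ let $\Phi_l(t)=\prod_{i=1}^{l-1}f_1\big((b^i+b^{2l-i})t\big)$, with $\Phi_0(t)=\Phi_1(t)=1$. The normalized version is $\tilde\Phi_l(t)=\frac{\Phi_l(t)}{(b-1)b^l}$, where $(b-1)b^l$ is the number of base-$b$ palindromes with exactly $2l+1$ digits (for $l\ge1$). $\tilde\Phi_l'$ is the derivative in $t$. The implied constants in $\ll$ may depend on $b$ but not on $l$. *)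

theory Defs
  imports "HOL-Analysis.Analysis"
begin

definition e :: "complex \<Rightarrow> complex" where
  "e z = exp (2 * of_real pi * \<i> * z)"

definition f1 :: "nat \<Rightarrow> real \<Rightarrow> complex" where
  "f1 b t = (\<Sum>n<b. e (of_real (real n * t)))"

(* The index range is empty for l = 0 and l = 1, which gives Phi b 0 t = Phi b 1 t = 1. *)
definition Phi :: "nat \<Rightarrow> nat \<Rightarrow> real \<Rightarrow> complex" where
  "Phi b l t = (\<Prod>i\<in>{1..<l}. f1 b ((real b ^ i + real b ^ (2 * l - i)) * t))"

(* For l \<ge> 1, (b - 1) * b ^ l is the number of base-b palindromes with exactly 2 * l + 1 digits. *)
definition Phi_norm :: "nat \<Rightarrow> nat \<Rightarrow> real \<Rightarrow> complex" where
  "Phi_norm b l t = Phi b l t / of_real ((real b - 1) * real b ^ l)"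

definition alpha :: "nat \<Rightarrow> real" where
  "alpha b = (ln (real b) - ln (4 + ln (real b / 2 - 1))) / (2 * ln (real b))"

end

theory Submission
  imports Defs
begin

text \<open>The factor of \<open>\<Phi>\<^sub>l\<close> with index \<open>i\<close> has period \<open>b\<^sup>-\<^sup>i\<close>, so averaging over the translations by
  \<open>k / b ^ (i + 1)\<close>, \<open>k < b\<close>, affects only the factors up to \<open>i\<close>, and turns the modulus of the
  factor \<open>i\<close> itself into a mean of \<open>|f\<^sub>1|\<close> over \<open>b\<close> equidistant points. By
  \<open>|f\<^sub>1(s)| \<le> min b (1 / sin (\<pi> s))\<close> and a harmonic sum, such a mean is at most
  \<open>M = 4 + log (b / 2 - 1)\<close>. Removing the factors one at a time, starting from the smallest index,
  bounds the integral by \<open>M ^ (l - 1)\<close>, and \<open>x powr \<alpha>\<^sub>b = (b / M) ^ l\<close>. The derivative is treated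
  by the product rule, where the differentiated factor is estimated trivially. Finally
  \<open>\<alpha>\<^sub>b > 1 / 3\<close> means \<open>M ^ 3 < b\<close>, and this holds from \<open>b = 1100\<close> on.\<close>

section \<open>Basic properties of the exponential sum\<close>

definition mean_bound :: "nat \<Rightarrow> real" where
  "mean_bound b = 4 + ln (real b / 2 - 1)"

definition freq :: "nat \<Rightarrow> nat \<Rightarrow> nat \<Rightarrow> real" where
  "freq b l i = real b ^ i + real b ^ (2 * l - i)"

lemma e_eq_cis: "e (of_real t) = cis (2 * pi * t)"
  by (simp add: e_def cis_conv_exp mult_ac)

lemma norm_e [simp]: "norm (e (of_real t)) = 1"
  by (simp add: e_eq_cis)

text \<open>As a geometric sum in a unit complex number, \<open>f1\<close> readily yields its
  period, trivial bound, continuity and closed form.\<close>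

lemma f1_cis: "f1 b t = (\<Sum>n<b. cis (2 * pi * t) ^ n)"
proof -
  have "e (of_real (real n * t)) = cis (2 * pi * t) ^ n" for n
    unfolding e_eq_cis Complex.DeMoivre by (rule arg_cong[where f = cis]) simp
  then show ?thesis unfolding f1_def by simp
qed

lemma f1_add_int: "a \<in> \<int> \<Longrightarrow> f1 b (t + a) = f1 b t"
  by (simp add: f1_cis distrib_left flip: cis_mult)

lemma norm_f1_le: "norm (f1 b t) \<le> real b"
  unfolding f1_cis by (rule order_trans[OF norm_sum]) (simp add: norm_power)

section \<open>Pointwise decay of the exponential sum\<close>

text \<open>Concavity puts the sine above its chord on [0, pi/2], so sin (pi s) >= 2 s on the left
  half; the factor 1 - s makes the bound symmetric under s -> 1 - s. The reciprocal of s (1 - s)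
  splits into partial fractions.\<close>

lemma sin_pi_ge:
  assumes "0 \<le> s" "s \<le> 1"
  shows "2 * (s * (1 - s)) \<le> sin (pi * s)"
proof -
  have conc: "concave_on {0..pi/2} sin"
    by (rule f''_le0_imp_concave[where f' = cos and f'' = "\<lambda>x. - sin x"])
       (auto intro!: derivative_eq_intros sin_ge_zero)
  have half: "2 * (s * (1 - s)) \<le> sin (pi * s)" if "0 \<le> s" "s \<le> 1/2" for s :: real
  proof -
    have "2 * s * (1 - s) \<le> 2 * s"
      using that by (simp add: mult_left_le)
    also have "2 * s \<le> sin (pi * s)"
      using concave_onD[OF conc, of "2 * s" 0 "pi/2"] that by (simp add: mult_ac)
    finally show ?thesis by (simp add: mult_ac)
  qed
  have "sin (pi * (1 - s)) = sin (pi * s)"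
    by (simp add: right_diff_distrib)
  then show ?thesis
    using half[of s] half[of "1 - s"] assms by (cases "s \<le> 1/2") (auto simp: mult_ac)
qed

text \<open>With z = e(s), |1 - z| = 2 |sin (pi s)| >= 4 s (1 - s) and |1 - z^b| <= 2, hence |f1| <=
  1 / (2 s (1 - s)). Partial fractions give a form that sums to harmonic numbers.\<close>

lemma norm_f1_le_inverse:
  assumes "0 < s" "s < 1"
  shows "norm (f1 b s) \<le> 1 / (2 * s) + 1 / (2 * (1 - s))"
proof -
  define z where "z = cis (2 * pi * s)"
  have "norm (1 - z) ^ 2 = (1 - cos (2 * (pi * s)))\<^sup>2 + (sin (2 * (pi * s)))\<^sup>2"
    by (simp add: z_def cmod_power2 mult_ac)
  also have "\<dots> = (2 * sin (pi * s)) ^ 2"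
    using sin_cos_squared_add[of "pi * s"] unfolding sin_double cos_double by algebra
  finally have "norm (1 - z) = \<bar>2 * sin (pi * s)\<bar>"
    by (metis abs_norm_cancel power2_eq_iff abs_minus_cancel)
  then have lower: "norm (1 - z) \<ge> 4 * (s * (1 - s))"
    using sin_pi_ge[of s] assms by simp
  have "norm (1 - z) * norm (f1 b s) = norm (1 - z ^ b)"
    unfolding f1_cis z_def[symmetric] by (simp add: one_diff_power_eq norm_mult)
  also have "\<dots> \<le> 2"
    by (rule order_trans[OF norm_triangle_ineq4]) (simp add: z_def norm_power)
  finally have "4 * (s * (1 - s)) * norm (f1 b s) \<le> 2"
    using mult_right_mono[OF lower, of "norm (f1 b s)"] by simp
  with assms show ?thesis
    by (simp add: field_simps)
qed

section \<open>Mean of the exponential sum over equidistant points\<close>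

text \<open>The difference \<open>harm n - ln n\<close> decreases from its value 1 at n = 1.\<close>

lemma harm_le_ln: "n > 0 \<Longrightarrow> harm n \<le> 1 + ln (real n)"
  using decseqD[OF decseq_harm_diff_ln, of 0 "n - 1"] by (simp add: harm_expand)

lemma ln2_le_1: "ln 2 \<le> (1::real)"
  using ln_le_minus_one[of 2] by simp

text \<open>For b >= 3 the logarithm is at least - log 2 >= -1. This secures M >= 1, so that powers
  of M grow with the exponent.\<close>

lemma mean_bound_ge: "b \<ge> 3 \<Longrightarrow> mean_bound b \<ge> 3"
proof -
  assume "b \<ge> 3"
  then have "ln (1/2) \<le> ln (real b / 2 - 1)"
    by (intro ln_mono) auto
  then show ?thesis
    using ln2_le_1 by (simp add: mean_bound_def ln_div)
qed

text \<open>The first and the last point may come close to an integer and get the trivial bound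
  \<open>b\<close>; the \<open>b - 2\<close> points between them are governed by their distances to
  0 and 1, which gives two harmonic sums of weight \<open>b / 2\<close>.\<close>

lemma sum_norm_f1_le_base:
  assumes b: "b \<ge> 3" and t: "0 \<le> t" "t < 1 / real b"
  shows "(\<Sum>k<b. norm (f1 b (t + real k / real b))) \<le> real b * mean_bound b"
proof -
  define n where "n = b - 2"
  have n: "b = Suc (Suc n)" "n > 0" using b by (auto simp: n_def)
  define a where "a = (\<lambda>k. norm (f1 b (t + real k / real b)))"
  \<comment> \<open>As 0 <= t < 1/b, the point t + (k + 1)/b is at least (k + 1)/b away from 0 and
    (b - 2 - k)/b away from 1.\<close>
  have bound: "a (Suc k) \<le> real b / 2 * (1 / real (Suc k) + 1 / real (n - k))" if "k < n" for k
  proof -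
    define s where "s = t + real (Suc k) / real b"
    have s: "real (Suc k) / real b \<le> s" "real (n - k) / real b \<le> 1 - s"
    proof -
      have "real (n - k) / real b = 1 - 1 / real b - real (Suc k) / real b"
      proof -
        have "real (n - k) = real b - 1 - real (Suc k)"
          using that by (simp add: n of_nat_diff)
        then show ?thesis using b by (simp only: diff_divide_distrib) simp
      qed
      then show "real (n - k) / real b \<le> 1 - s" using t by (simp add: s_def)
    qed (use t in \<open>simp add: s_def\<close>)
    have pos: "0 < real (Suc k) / real b" "0 < real (n - k) / real b"
      using that b by auto
    have "a (Suc k) \<le> 1 / (2 * s) + 1 / (2 * (1 - s))"
      unfolding a_def s_def[symmetric] using s pos by (intro norm_f1_le_inverse) linarith+
    also have "\<dots> \<le> 1 / (2 * (real (Suc k) / real b)) + 1 / (2 * (real (n - k) / real b))"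
      using s pos by (intro add_mono divide_left_mono mult_left_mono mult_pos_pos) linarith+
    finally show ?thesis
      by (simp add: distrib_left)
  qed
  have "(\<Sum>k<b. a k) = a 0 + (\<Sum>k<n. a (Suc k)) + a (Suc n)"
    using sum.lessThan_Suc_shift[of a "Suc n"] sum.lessThan_Suc[of "\<lambda>k. a (Suc k)" n]
    by (simp only: n(1) add.assoc)
  also have "\<dots> \<le> real b + (\<Sum>k<n. real b / 2 * (1 / real (Suc k) + 1 / real (n - k))) + real b"
    by (intro add_mono sum_mono bound) (auto simp: a_def norm_f1_le)
  also have "(\<Sum>k<n. real b / 2 * (1 / real (Suc k) + 1 / real (n - k))) = real b * harm n"
  proof -
    have "(\<Sum>k<n. 1 / real (n - k)) = (\<Sum>k<n. 1 / real (Suc k))"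
      using sum.nat_diff_reindex[of "\<lambda>k. 1 / real (Suc k)" n]
      by (metis (no_types, lifting) Suc_diff_Suc lessThan_iff sum.cong)
    then show ?thesis
      unfolding sum_distrib_left[symmetric] sum.distrib harm_altdef
      by (simp add: inverse_eq_divide)
  qed
  also have "real b + real b * harm n + real b = real b * (2 + harm n)"
    by (simp add: algebra_simps)
  also have "\<dots> \<le> real b * mean_bound b"
  \<comment> \<open>Since log (b/2 - 1) = log n - log 2, the claim is \<open>harm n\<close> <= 2 +
    log n - log 2, which holds with slack 1 - log 2.\<close>
  proof (rule mult_left_mono)
    have half: "real b / 2 - 1 = real n / 2" by (simp add: n field_simps)
    have "mean_bound b = 4 + (ln (real n) - ln 2)"
      unfolding mean_bound_def half using n(2) by (simp add: ln_div)
    then show "2 + harm n \<le> mean_bound b"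
      using harm_le_ln[OF n(2)] ln2_le_1 by linarith
  qed simp
  finally show ?thesis by (simp add: a_def)
qed

text \<open>Translation by 1/b permutes the \<open>b\<close> points modulo 1, so the sum has period
  1/b and \<open>t\<close> can be reduced to [0, 1/b).\<close>

lemma sum_norm_f1_le:
  assumes b: "b \<ge> 3"
  shows "(\<Sum>k<b. norm (f1 b (t + real k / real b))) \<le> real b * mean_bound b"
proof -
  define g where "g = (\<lambda>t. \<Sum>k<b. norm (f1 b (t + real k / real b)))"
  have step: "g (t + 1 / real b) = g t" for t
  proof -
    define a where "a = (\<lambda>k. norm (f1 b (t + real k / real b)))"
    have "a b = a 0"
      using b f1_add_int[of 1 b t] by (simp add: a_def)
    moreover have "sum a {..<Suc b} = a 0 + (\<Sum>k<b. a (Suc k))"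
      by (rule sum.lessThan_Suc_shift)
    ultimately have "(\<Sum>k<b. a (Suc k)) = sum a {..<b}" by simp
    then show ?thesis
      by (simp add: g_def a_def add_divide_distrib add_ac)
  qed
  have nat: "g (t + real n / real b) = g t" for n t
  proof (induction n)
    case (Suc n)
    have "g (t + real (Suc n) / real b) = g (t + real n / real b + 1 / real b)"
      by (simp add: add_divide_distrib add_ac)
    then show ?case using step Suc by simp
  qed simp
  define m where "m = \<lfloor>real b * t\<rfloor>"
  define u where "u = t - of_int m / real b"
  have "of_int m \<le> real b * t" "real b * t < of_int m + 1"
    by (auto simp: m_def)
  moreover have "real b * u = real b * t - of_int m"
    using b by (simp add: u_def right_diff_distrib)
  ultimately have "0 \<le> real b * u" "real b * u < 1" by linarith+
  then have u: "0 \<le> u" "u < 1 / real b"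
    using b by (simp_all add: zero_le_mult_iff pos_less_divide_eq mult.commute)
  have "g t = g u"
  \<comment> \<open>The fact \<open>nat\<close> only moves to the right, so the walk starts at
    \<open>u\<close> or at \<open>t\<close> according to the sign of \<open>m\<close>.\<close>
  proof (cases "m \<ge> 0")
    case True
    then show ?thesis using nat[of u "nat m"] by (simp add: u_def)
  next
    case False
    then show ?thesis using nat[of t "nat (-m)"] by (simp add: u_def)
  qed
  then show ?thesis
    using sum_norm_f1_le_base[OF b u] by (simp add: g_def)
qed

section \<open>Integrals of products by averaging over translations\<close>

text \<open>The interval [c, 1 + c] is cut at 1, and the part beyond 1 is moved back by one period
  to [0, c].\<close>

lemma integral_shift_periodic:
  fixes g :: "real \<Rightarrow> real"
  assumes cont: "continuous_on UNIV g" and per: "\<And>t. g (t + 1) = g t"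
    and c: "0 \<le> c" "c \<le> 1"
  shows "integral {0..1} (\<lambda>t. g (t + c)) = integral {0..1} g"
proof -
  have int: "g integrable_on {a..b}" for a b
    by (rule integrable_continuous_real) (rule continuous_on_subset[OF cont], simp)
  have shift: "integral {a..b} (\<lambda>t. g (t + d)) = integral {a+d..b+d} g" for a b d
  proof -
    have "((\<lambda>t. g (1 *\<^sub>R t + d)) has_integral
        (1 / \<bar>1\<bar> ^ DIM(real)) *\<^sub>R integral {a+d..b+d} g)
        ((\<lambda>x. (1/1) *\<^sub>R x + - ((1/1) *\<^sub>R d)) ` cbox (a+d) (b+d))"
      by (rule has_integral_affinity) (use integrable_integral[OF int] in auto)
    moreover have "(\<lambda>x. (1/1) *\<^sub>R x + - ((1/1) *\<^sub>R d)) ` cbox (a+d) (b+d) = {a..b}"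
      using image_add_atLeastAtMost[of "-d" "a+d" "b+d"] by (simp add: add.commute)
    ultimately show ?thesis
      by (simp add: integral_unique)
  qed
  have "integral {0..1} (\<lambda>t. g (t + c)) = integral {c..1+c} g"
    using shift[of 0 1 c] by simp
  also have "\<dots> = integral {c..1} g + integral {1..1+c} g"
    by (rule Henstock_Kurzweil_Integration.integral_combine[symmetric]) (use c int in auto)
  also have "integral {1..1+c} g = integral {0..c} g"
    using shift[of 0 c 1] by (simp add: per add.commute)
  also have "integral {c..1} g + integral {0..c} g = integral {0..1} g"
    using Henstock_Kurzweil_Integration.integral_combine[OF c int] by simp
  finally show ?thesis .
qed

lemma continuous_on_f1 [continuous_intros]:
  "continuous_on S h \<Longrightarrow> continuous_on S (\<lambda>t. f1 b (h t))"
  unfolding f1_cis by (intro continuous_intros continuous_on_cis)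

text \<open>Since 2 l - i > i >= j, \<open>b ^ j\<close> divides both powers in the frequency. Thus
  translation by k / b^j fixes every factor of index at least \<open>j\<close>; the case j = 0 is
  the period 1.\<close>

lemma freq_div_power_int:
  assumes "b > 0" "i < l" "j \<le> i"
  shows "freq b l i * (real k / real b ^ j) \<in> \<int>"
proof -
  have "freq b l i * (real k / real b ^ j) = (real b ^ (i - j) + real b ^ (2 * l - i - j)) * real k"
  proof -
    have "real b ^ (i - j) = real b ^ i / real b ^ j"
      using assms by (intro power_diff) auto
    moreover have "real b ^ (2 * l - i - j) = real b ^ (2 * l - i) / real b ^ j"
      using assms by (intro power_diff) auto
    ultimately show ?thesis
      by (simp only: freq_def) (simp add: add_divide_distrib distrib_right)
  qed
  then show ?thesis by simp
qed

text \<open>The index set is arbitrary because the product rule leaves out one factor. Induction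
  adds a new least index \<open>j\<close>, so that averaging over the translations
  \<open>c k\<close> leaves the remaining product \<open>P\<close> fixed.\<close>

lemma integral_prod_f1_le:
  assumes b: "b \<ge> 3" and "finite S" "S \<subseteq> {1..<l}"
  shows "integral {0..1} (\<lambda>t. \<Prod>i\<in>S. norm (f1 b (freq b l i * t))) \<le> mean_bound b ^ card S"
  using assms(2,3)
proof (induction S rule: finite_linorder_min_induct)
  case empty
  then show ?case by simp
next
  case (insert j S)
  define F where "F = (\<lambda>i t. norm (f1 b (freq b l i * t)))"
  define P where "P = (\<lambda>t. \<Prod>i\<in>S. F i t)"
  have j: "j \<notin> S" "0 < j" "j < l" using insert by auto
  have contF: "continuous_on A (F i)" for A i
    unfolding F_def by (intro continuous_intros)
  have contP: "continuous_on A P" for A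
    unfolding P_def by (intro continuous_intros contF)
  have shiftF: "F i (t + c) = F i t" if "freq b l i * c \<in> \<int>" for i t c
    using that by (simp add: F_def distrib_left f1_add_int)
  have per: "F j (t + 1) * P (t + 1) = F j t * P t" for t
  proof -
    have "F i (t + 1) = F i t" if "i < l" for i
      using freq_div_power_int[of b i l 0 1] that b by (intro shiftF) simp
    then show ?thesis using insert.prems
      by (auto simp: P_def intro!: arg_cong2[where f = "(*)"] prod.cong)
  qed
  define c where "c = (\<lambda>k. real k / real b ^ Suc j)"
  have shiftP: "P (t + c k) = P t" for t k
    unfolding P_def
  proof (rule prod.cong[OF refl])
    fix i assume "i \<in> S"
    then have "Suc j \<le> i" "i < l" using insert by (auto simp: Suc_le_eq)
    then show "F i (t + c k) = F i t"
      unfolding c_def using b by (intro shiftF freq_div_power_int) auto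
  qed
  have shiftj: "F j (t + c k) = norm (f1 b (freq b l j * t + real k / real b))" for t k
  proof -
    \<comment> \<open>Here j < l gives 2 j + 1 <= 2 l, so the truncated subtraction is exact: the
      high power of the frequency contributes an integer, the low one k / b.\<close>
    define r where "r = 2 * l - j - Suc j"
    have "2 * l - j = Suc j + r" using j by (simp add: r_def)
    then have "freq b l j * c k = real k / real b + real b ^ r * real k"
      using b unfolding freq_def c_def by (simp add: field_simps power_add)
    then have "freq b l j * (t + c k) = freq b l j * t + real k / real b + real (b ^ r * k)"
      by (simp add: distrib_left)
    then show ?thesis
      unfolding F_def by (simp only: f1_add_int Ints_of_nat)
  qed
  have c01: "0 \<le> c k \<and> c k \<le> 1" if "k < b" for k
  proof -
    have "real k \<le> real b ^ 1" using that by simp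
    also have "\<dots> \<le> real b ^ Suc j" using b by (intro power_increasing) auto
    finally show ?thesis using b by (simp add: c_def)
  qed
  have contk: "continuous_on {0..1} (\<lambda>t. F j (t + c k) * P t)" for k
    unfolding shiftj by (intro continuous_intros contP)
  have "real b * integral {0..1} (\<lambda>t. F j t * P t)
      = (\<Sum>k<b. integral {0..1} (\<lambda>t. F j (t + c k) * P (t + c k)))"
    using integral_shift_periodic[of "\<lambda>t. F j t * P t"] c01
    by (simp add: per continuous_on_mult contF contP)
  also have "\<dots> = integral {0..1} (\<lambda>t. \<Sum>k<b. F j (t + c k) * P t)"
    unfolding shiftP by (intro integral_sum[symmetric] integrable_continuous_real contk) auto
  \<comment> \<open>With \<open>P\<close> factored out, the sum runs over \<open>b\<close>
    equidistant points and is bounded uniformly in \<open>t\<close>.\<close>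
  also have "\<dots> \<le> integral {0..1} (\<lambda>t. real b * mean_bound b * P t)"
  proof (rule integral_le)
    fix t :: real
    have "0 \<le> P t" by (simp add: P_def F_def prod_nonneg)
    then show "(\<Sum>k<b. F j (t + c k) * P t) \<le> real b * mean_bound b * P t"
      unfolding sum_distrib_right[symmetric] shiftj
      by (intro mult_right_mono sum_norm_f1_le b)
  qed (intro integrable_continuous_real continuous_intros contk contP)+
  also have "\<dots> = real b * (mean_bound b * integral {0..1} P)"
    by simp
  finally have "integral {0..1} (\<lambda>t. F j t * P t) \<le> mean_bound b * integral {0..1} P"
    using b by simp
  also have "\<dots> \<le> mean_bound b * mean_bound b ^ card S"
    using insert mean_bound_ge[OF b] by (intro mult_left_mono) (auto simp: P_def F_def)
  finally show ?case
    using insert.hyps j by (simp add: P_def F_def)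
qed

lemma integral_norm_Phi_le:
  assumes "b \<ge> 3"
  shows "integral {0..1} (\<lambda>t. norm (Phi b l t)) \<le> mean_bound b ^ (l - 1)"
  using integral_prod_f1_le[OF assms, of "{1..<l}" l]
  by (simp add: Phi_def prod_norm freq_def)

section \<open>The derivative of the product\<close>

text \<open>A non-integrable \<open>f\<close> has integral 0 by convention, which nonnegativity of
  \<open>g\<close> covers. This compares the norm of a derivative with a continuous
  majorant.\<close>

lemma integral_mono_nonneg:
  fixes f g :: "real \<Rightarrow> real"
  assumes "g integrable_on S" "\<And>x. x \<in> S \<Longrightarrow> 0 \<le> f x" "\<And>x. x \<in> S \<Longrightarrow> f x \<le> g x"
  shows "integral S f \<le> integral S g"
proof (cases "f integrable_on S")
  case True
  then show ?thesis using assms by (intro integral_le) auto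
next
  case False
  have "0 \<le> integral S g"
    using assms by (intro integral_nonneg) (auto intro: order_trans)
  then show ?thesis using False by (simp add: not_integrable_integral)
qed

lemma e_scaled_has_vector_derivative:
  "((\<lambda>t. e (of_real (a * t))) has_vector_derivative
      of_real (2 * pi * a) * \<i> * e (of_real (a * t))) (at t)"
proof -
  have "((\<lambda>z. e (of_real a * z)) has_field_derivative
      2 * of_real pi * of_real a * \<i> * e (of_real a * of_real t)) (at (of_real t))"
    unfolding e_def by (auto intro!: derivative_eq_intros)
  from has_vector_derivative_real_field[OF this] show ?thesis by (simp add: o_def)
qed

lemma f1_has_vector_derivative:
  "\<exists>D. (f1 b has_vector_derivative D) (at t) \<and> norm D \<le> 2 * pi * real b ^ 2"
proof -
  define D where "D = (\<Sum>n<b. of_real (2 * pi * real n) * \<i> * e (of_real (real n * t)))"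
  have "(f1 b has_vector_derivative D) (at t)"
    unfolding D_def f1_def[abs_def]
    by (intro has_vector_derivative_sum e_scaled_has_vector_derivative)
  moreover have "norm D \<le> (\<Sum>n<b. 2 * pi * real b)"
    unfolding D_def by (intro sum_norm_le) (auto simp only: norm_mult norm_e norm_of_real, simp)
  ultimately show ?thesis
    by (intro exI[of _ D]) (simp add: power2_eq_square mult_ac)
qed

lemma freq_nonneg: "freq b l i \<ge> 0"
  by (simp add: freq_def)

text \<open>Both exponents are at most 2 l. This is the source of the factor x = b^(2 l) in the
  derivative bound.\<close>

lemma freq_le: "b > 0 \<Longrightarrow> i < l \<Longrightarrow> freq b l i \<le> 2 * real b ^ (2 * l)"
  using power_increasing[of i "2 * l" "real b"] power_increasing[of "2 * l - i" "2 * l" "real b"]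
  by (simp add: freq_def)

text \<open>By the product and chain rules, the differentiated factor contributes its frequency
  times the trivial bound for the derivative of \<open>f1\<close>; the other factors keep their
  moduli, to be integrated later.\<close>

lemma Phi_has_vector_derivative:
  "\<exists>D. (Phi b l has_vector_derivative D) (at t) \<and>
    norm D \<le> (\<Sum>j\<in>{1..<l}. freq b l j * (2 * pi * real b ^ 2) *
      (\<Prod>i\<in>{1..<l}-{j}. norm (f1 b (freq b l i * t))))"
proof -
  obtain d where d: "\<And>t. (f1 b has_vector_derivative d t) (at t)"
      "\<And>t. norm (d t) \<le> 2 * pi * real b ^ 2"
    using f1_has_vector_derivative[of b] by metis
  define D where "D = (\<Sum>j\<in>{1..<l}. (freq b l j *\<^sub>R d (freq b l j * t)) *
      (\<Prod>i\<in>{1..<l}-{j}. f1 b (freq b l i * t)))"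
  have d': "((\<lambda>t. f1 b (freq b l j * t)) has_derivative
      (\<lambda>y. y *\<^sub>R (freq b l j *\<^sub>R d (freq b l j * t)))) (at t)" for j
  proof -
    have "((\<lambda>t. freq b l j * t) has_vector_derivative freq b l j) (at t)"
      by (auto intro!: derivative_eq_intros)
    from vector_diff_chain_at[OF this d(1)[of "freq b l j * t"]]
    show ?thesis by (simp add: o_def has_vector_derivative_def)
  qed
  have "((\<lambda>t. \<Prod>i\<in>{1..<l}. f1 b (freq b l i * t)) has_derivative
      (\<lambda>y. \<Sum>j\<in>{1..<l}. (y *\<^sub>R (freq b l j *\<^sub>R d (freq b l j * t))) *
        (\<Prod>i\<in>{1..<l}-{j}. f1 b (freq b l i * t)))) (at t)"
    by (rule has_derivative_prod) (rule d')
  then have "(Phi b l has_vector_derivative D) (at t)"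
    unfolding has_vector_derivative_def D_def Phi_def[abs_def] freq_def
    by (simp add: scaleR_sum_right)
  moreover have "norm D \<le> (\<Sum>j\<in>{1..<l}. freq b l j * (2 * pi * real b ^ 2) *
      (\<Prod>i\<in>{1..<l}-{j}. norm (f1 b (freq b l i * t))))"
    unfolding D_def
  proof (rule sum_norm_le)
    fix j
    have "freq b l j * norm (d (freq b l j * t)) \<le> freq b l j * (2 * pi * real b ^ 2)"
      by (intro mult_left_mono d freq_nonneg)
    then show "norm (freq b l j *\<^sub>R d (freq b l j * t) * (\<Prod>i\<in>{1..<l}-{j}. f1 b (freq b l i * t)))
        \<le> freq b l j * (2 * pi * real b ^ 2) * (\<Prod>i\<in>{1..<l}-{j}. norm (f1 b (freq b l i * t)))"
      by (simp add: norm_mult prod_norm freq_nonneg mult_right_mono prod_nonneg flip: mult.assoc)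
  qed
  ultimately show ?thesis by blast
qed

lemma integral_norm_Phi_deriv_le:
  assumes b: "b \<ge> 3"
  shows "integral {0..1} (\<lambda>t. norm (vector_derivative (Phi b l) (at t)))
    \<le> 4 * pi * real b ^ 2 * (real l * real b ^ (2 * l) * mean_bound b ^ l)"
proof -
  define Q where "Q = (\<lambda>j t. \<Prod>i\<in>{1..<l}-{j}. norm (f1 b (freq b l i * t)))"
  define K where "K = 2 * pi * real b ^ 2"
  have contQ: "continuous_on {0..1} (Q j)" for j
    unfolding Q_def by (intro continuous_intros)
  have M: "mean_bound b \<ge> 1" using mean_bound_ge[OF b] by simp
  have "integral {0..1} (\<lambda>t. norm (vector_derivative (Phi b l) (at t)))
      \<le> integral {0..1} (\<lambda>t. \<Sum>j\<in>{1..<l}. freq b l j * K * Q j t)"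
  proof (rule integral_mono_nonneg)
    fix t
    show "norm (vector_derivative (Phi b l) (at t)) \<le> (\<Sum>j\<in>{1..<l}. freq b l j * K * Q j t)"
      using Phi_has_vector_derivative[of b l t] unfolding K_def Q_def
      by (auto simp: vector_derivative_at)
  qed (auto intro!: integrable_continuous_real continuous_intros contQ)
  also have "\<dots> = (\<Sum>j\<in>{1..<l}. freq b l j * K * integral {0..1} (Q j))"
    by (subst integral_sum) (auto intro!: integrable_continuous_real continuous_intros contQ)
  also have "\<dots> \<le> (\<Sum>j\<in>{1..<l}. 2 * real b ^ (2 * l) * K * mean_bound b ^ l)"
  proof (rule sum_mono)
    fix j assume j: "j \<in> {1..<l}"
    have "integral {0..1} (Q j) \<le> mean_bound b ^ card ({1..<l}-{j})"
      unfolding Q_def by (rule integral_prod_f1_le[OF b]) auto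
    \<comment> \<open>One of the l - 1 indices is missing; as M >= 1, the exponent l - 2 may be
      raised to l.\<close>
    also have "\<dots> \<le> mean_bound b ^ l"
      using j M by (intro power_increasing) (auto simp: card_Diff_singleton)
    finally have "integral {0..1} (Q j) \<le> mean_bound b ^ l" .
    moreover have "0 \<le> integral {0..1} (Q j)"
      by (intro integral_nonneg integrable_continuous_real contQ) (auto simp: Q_def prod_nonneg)
    ultimately show "freq b l j * K * integral {0..1} (Q j)
        \<le> 2 * real b ^ (2 * l) * K * mean_bound b ^ l"
      using j b M by (intro mult_mono freq_le) (auto simp: K_def freq_nonneg)
  qed
  also have "\<dots> = real (l - 1) * (2 * real b ^ (2 * l) * K * mean_bound b ^ l)"
    by simp
  also have "\<dots> \<le> real l * (2 * real b ^ (2 * l) * K * mean_bound b ^ l)"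
    using M by (intro mult_right_mono) (auto simp: K_def)
  finally show ?thesis
    by (simp add: K_def mult_ac)
qed

section \<open>Normalized products\<close>

text \<open>The factor b - 1 >= 1 is dropped and the exponent l - 1 raised to l, leaving a pure l-th
  power to match x powr \<alpha>.\<close>

lemma integral_norm_Phi_norm_le:
  assumes b: "b \<ge> 3"
  shows "integral {0..1} (\<lambda>t. norm (Phi_norm b l t)) \<le> (mean_bound b / real b) ^ l"
proof -
  have M: "mean_bound b \<ge> 1" using mean_bound_ge[OF b] by simp
  have "integral {0..1} (\<lambda>t. norm (Phi_norm b l t))
      = integral {0..1} (\<lambda>t. norm (Phi b l t)) / ((real b - 1) * real b ^ l)"
  proof -
    have "\<bar>(real b - 1) * real b ^ l\<bar> = (real b - 1) * real b ^ l"
      using b by (intro abs_of_nonneg mult_nonneg_nonneg) auto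
    then show ?thesis
      by (simp only: Phi_norm_def norm_divide norm_of_real integral_divide)
  qed
  also have "\<dots> \<le> mean_bound b ^ l / (1 * real b ^ l)"
  proof (rule frac_le)
    have "mean_bound b ^ (l - 1) \<le> mean_bound b ^ l"
      using M by (intro power_increasing) auto
    then show "integral {0..1} (\<lambda>t. norm (Phi b l t)) \<le> mean_bound b ^ l"
      using integral_norm_Phi_le[OF b, of l] by simp
    show "1 * real b ^ l \<le> (real b - 1) * real b ^ l"
      using b by (intro mult_right_mono) auto
  qed (use b M in auto)
  finally show ?thesis by (simp add: power_divide)
qed

lemma integral_norm_Phi_norm_deriv_le:
  assumes b: "b \<ge> 3"
  shows "integral {0..1} (\<lambda>t. norm (vector_derivative (Phi_norm b l) (at t)))
    \<le> 4 * pi * real b ^ 2 * (real l * (real b ^ (2 * l) * (mean_bound b / real b) ^ l))"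
proof -
  define c where "c = (real b - 1) * real b ^ l"
  have M: "mean_bound b \<ge> 0" using mean_bound_ge[OF b] by simp
  have c: "c \<ge> real b ^ l"
    using b mult_right_mono[of 1 "real b - 1" "real b ^ l"] by (simp add: c_def)
  moreover have "real b ^ l > 0" using b by simp
  ultimately have c0: "c > 0" by linarith
  have "vector_derivative (Phi_norm b l) (at t) = vector_derivative (Phi b l) (at t) / of_real c" for t
  proof -
    obtain D where D: "(Phi b l has_vector_derivative D) (at t)"
      using Phi_has_vector_derivative by blast
    then have "(Phi_norm b l has_vector_derivative D / of_real c) (at t)"
      unfolding Phi_norm_def[abs_def] c_def by (rule has_vector_derivative_divide)
    with D show ?thesis by (simp add: vector_derivative_at)
  qed
  then have "integral {0..1} (\<lambda>t. norm (vector_derivative (Phi_norm b l) (at t)))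
      = integral {0..1} (\<lambda>t. norm (vector_derivative (Phi b l) (at t))) / c"
    using c0 by (simp add: norm_divide)
  also have "\<dots> \<le> 4 * pi * real b ^ 2 * (real l * real b ^ (2 * l) * mean_bound b ^ l) / real b ^ l"
    using c b M by (intro frac_le integral_norm_Phi_deriv_le) auto
  finally show ?thesis
    by (simp add: power_divide mult_ac)
qed

section \<open>The exponent and its size\<close>

lemma alpha_eq: "alpha b = (ln (real b) - ln (mean_bound b)) / (2 * ln (real b))"
  by (simp add: alpha_def mean_bound_def)

text \<open>The denominator of \<open>alpha\<close> is made for x = b^(2 l): since 2
  \<open>alpha b\<close> log b = log (b / M), the logarithm of the left side is l log (b /
  M).\<close>

lemma powr_alpha:
  assumes b: "b \<ge> 3"
  shows "(real b ^ (2 * l)) powr alpha b = (real b / mean_bound b) ^ l"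
proof -
  have M: "mean_bound b > 0" using mean_bound_ge[OF b] by simp
  have "ln (real b) > 0" using b by simp
  then have "alpha b * (2 * ln (real b)) = ln (real b / mean_bound b)"
    using M b by (simp add: alpha_eq ln_div)
  then have "alpha b * (real (2 * l) * ln (real b)) = real l * ln (real b / mean_bound b)"
    by (simp add: algebra_simps)
  moreover have "exp (real l * ln (real b / mean_bound b)) = (real b / mean_bound b) ^ l"
    unfolding exp_of_nat_mult using b M by simp
  moreover have "(real b ^ (2 * l)) powr alpha b = exp (alpha b * (real (2 * l) * ln (real b)))"
    using b by (simp add: powr_def ln_realpow)
  ultimately show ?thesis by metis
qed

text \<open>For y = b^(1/3) it suffices that 4 + 3 log y - log 2 < y. By concavity 3 log y lies
  below its tangent at \<open>y0\<close>, whose slope 3 / \<open>y0\<close> is less than 1, so the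
  inequality at \<open>y0\<close> is enough.\<close>

lemma mean_bound_cubed_less:
  assumes b: "b \<ge> 1100"
  shows "mean_bound b ^ 3 < real b"
proof -
  define y where "y = root 3 (real b)"
  define y0 :: real where "y0 = 10.32" \<comment> \<open>a tangent point for \<open>ln\<close> just below the cube root of 1100\<close>
  have y3: "y ^ 3 = real b" by (simp add: y_def)
  have ypos: "y > 0" using b by (simp add: y_def)
  have yge: "y > y0"
  proof (rule power_less_imp_less_base)
    show "y0 ^ 3 < y ^ 3" using b unfolding y3 by (simp add: y0_def power3_eq_cube)
  qed (use ypos in simp)
  have exp1: "2.718 \<le> exp (1::real)"
  proof -
    have "(2.718::real) \<le> (\<Sum>n<7. 1 ^ n /\<^sub>R fact n)"
      by (simp add: eval_nat_numeral field_simps)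
    also have "\<dots> \<le> exp 1"
      unfolding exp_def by (intro sum_le_suminf summable_exp_generic) auto
    finally show ?thesis .
  qed
  \<comment> \<open>The number 6.32 is \<open>y0\<close> - 4. Its exponential is bounded below as
    e^6 times the quadratic Taylor polynomial of exp at 0.32.\<close>
  have "y0 ^ 3 / 2 < 2.718 ^ 6 * (1 + 0.32 + 0.32\<^sup>2 / 2)"
    by (simp add: y0_def eval_nat_numeral)
  also have "\<dots> \<le> exp 1 ^ 6 * exp 0.32"
    by (intro mult_mono power_mono exp1 exp_lower_Taylor_quadratic) auto
  also have "\<dots> = exp (6.32::real)" by (simp flip: exp_of_nat_mult exp_add)
  finally have "ln (y0 ^ 3 / 2) < 6.32"
    using ln_less_cancel_iff[of "y0 ^ 3 / 2" "exp 6.32"] by (simp add: y0_def)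
  then have base: "3 * ln y0 < 6.32 + ln 2"
    by (simp add: y0_def ln_div ln_realpow)
  have "ln y - ln y0 = ln (y / y0)"
    by (rule ln_divide_pos[symmetric]) (use ypos in \<open>auto simp: y0_def\<close>)
  also have "\<dots> \<le> y / y0 - 1"
    using ypos by (intro ln_le_minus_one) (simp add: y0_def)
  also have "\<dots> \<le> (y - y0) / 3"
    using yge by (simp add: y0_def field_simps)
  finally have tangent: "3 * ln y \<le> 3 * ln y0 + (y - y0)" by simp
  have "ln (real b / 2 - 1) \<le> ln (real b / 2)"
    using b by (intro ln_mono) auto
  also have "\<dots> = 3 * ln y - ln 2"
    using ypos by (simp add: ln_div ln_realpow flip: y3)
  finally have "mean_bound b < y"
    using tangent base by (simp add: mean_bound_def y0_def)
  moreover have "mean_bound b \<ge> 0" using mean_bound_ge[of b] b by simp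
  ultimately show ?thesis
    unfolding y3[symmetric] by (intro power_strict_mono) auto
qed

lemma alpha_greater_third:
  assumes b: "b \<ge> 1100"
  shows "alpha b > 1 / 3"
proof -
  have M: "mean_bound b > 0" using mean_bound_ge[of b] b by simp
  have "ln (mean_bound b ^ 3) < ln (real b)"
    using mean_bound_cubed_less[OF b] M b by simp
  then have "3 * ln (mean_bound b) < ln (real b)"
    using M by (simp add: ln_realpow)
  moreover have "ln (real b) > 0" using b by simp
  ultimately show ?thesis
    by (simp add: alpha_eq field_simps)
qed

text \<open>This absorbs the factor \<open>l\<close> into a small power of x: u <= exp u for u = 2
  \<delta> l log b, and 2 log b >= 1.\<close>

lemma nat_le_powr:
  assumes "b \<ge> 3" "\<delta> > 0"
  shows "real l \<le> 1 / \<delta> * (real b ^ (2 * l)) powr \<delta>"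
proof -
  have ln: "ln (real b) \<ge> 1 / 2"
  proof -
    have "1 / real b \<le> 1 / 2" using assms by simp
    moreover have "ln (1 / real b) \<le> 1 / real b - 1"
      using assms by (intro ln_le_minus_one) simp
    ultimately have "ln (1 / real b) \<le> - (1 / 2)" by linarith
    then show ?thesis using assms by (simp add: ln_div)
  qed
  have "\<delta> * real l \<le> \<delta> * (real (2 * l) * ln (real b))"
    using assms ln mult_left_mono[OF ln, of "2 * real l"] by (intro mult_left_mono) auto
  also have "\<dots> \<le> exp (\<delta> * (real (2 * l) * ln (real b)))"
    using exp_ge_add_one_self[of "\<delta> * (real (2 * l) * ln (real b))"] by linarith
  also have "\<dots> = (real b ^ (2 * l)) powr \<delta>"
    using assms by (simp add: powr_def ln_realpow)
  finally show ?thesis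
    using assms by (simp add: field_simps)
qed

theorem lemma3p3:
  fixes b :: nat
  assumes "b \<ge> 3"
  shows
    "((\<exists>C>0. \<forall>(l::nat) (x::real). l \<ge> 1 \<longrightarrow> x = real b ^ (2 * l) \<longrightarrow>
         integral {0..1} (\<lambda>t. norm (Phi_norm b l t)) \<le> C * (1 / x powr alpha b)) \<and>
      (\<exists>C>0. \<forall>(l::nat) (x::real). l \<ge> 1 \<longrightarrow> x = real b ^ (2 * l) \<longrightarrow>
         integral {0..1} (\<lambda>t. norm (vector_derivative (Phi_norm b l) (at t)))
           \<le> C * (real l * x powr (1 - alpha b)))) \<and>
     (b \<ge> 1100 \<longrightarrow>
      (\<exists>\<delta>>0.
        (\<exists>C>0. \<forall>(l::nat) (x::real). l \<ge> 1 \<longrightarrow> x = real b ^ (2 * l) \<longrightarrow>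
           integral {0..1} (\<lambda>t. norm (Phi_norm b l t)) \<le> C * (1 / x powr (1 / 3 + \<delta>))) \<and>
        (\<exists>C>0. \<forall>(l::nat) (x::real). l \<ge> 1 \<longrightarrow> x = real b ^ (2 * l) \<longrightarrow>
           integral {0..1} (\<lambda>t. norm (vector_derivative (Phi_norm b l) (at t)))
             \<le> C * x powr (2 / 3 - \<delta>))))"
proof -
  define X where "X = (\<lambda>l. real b ^ (2 * l))"
  define K where "K = 4 * pi * real b ^ 2"
  have X1: "X l \<ge> 1" for l using assms by (simp add: X_def)
  have K: "K > 0" using assms by (simp add: K_def)
  have bound: "integral {0..1} (\<lambda>t. norm (Phi_norm b l t)) \<le> 1 / X l powr alpha b" for l
    using integral_norm_Phi_norm_le[OF assms, of l] powr_alpha[OF assms, of l]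
    by (simp add: X_def power_divide)
  have bound': "integral {0..1} (\<lambda>t. norm (vector_derivative (Phi_norm b l) (at t)))
      \<le> K * (real l * X l powr (1 - alpha b))" for l
  proof -
    have "X l powr (1 - alpha b) = real b ^ (2 * l) * (mean_bound b / real b) ^ l"
      using X1[of l] powr_alpha[OF assms, of l]
      by (simp add: X_def powr_diff power_divide)
    then show ?thesis
      using integral_norm_Phi_norm_deriv_le[OF assms, of l] by (simp add: K_def)
  qed
  have "\<exists>\<delta>>0. (\<exists>C>0. \<forall>l. integral {0..1} (\<lambda>t. norm (Phi_norm b l t)) \<le> C * (1 / X l powr (1 / 3 + \<delta>))) \<and>
      (\<exists>C>0. \<forall>l. integral {0..1} (\<lambda>t. norm (vector_derivative (Phi_norm b l) (at t)))
             \<le> C * X l powr (2 / 3 - \<delta>))" if b: "b \<ge> 1100"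
  proof -
    \<comment> \<open>Half of the gap between \<open>alpha b\<close> and 1/3 is spent on absorbing
      \<open>l\<close>: 1 - \<open>alpha b\<close> + \<delta> = 2/3 - \<delta>.\<close>
    define \<delta> where "\<delta> = (alpha b - 1 / 3) / 2"
    have \<delta>: "\<delta> > 0" "alpha b = 1 / 3 + 2 * \<delta>"
      using alpha_greater_third[OF b] by (auto simp: \<delta>_def field_simps)
    have "integral {0..1} (\<lambda>t. norm (Phi_norm b l t)) \<le> 1 * (1 / X l powr (1 / 3 + \<delta>))" for l
    proof -
      have "1 / X l powr alpha b \<le> 1 / X l powr (1 / 3 + \<delta>)"
        using X1[of l] \<delta> by (intro divide_left_mono powr_mono mult_pos_pos) auto
      then show ?thesis using bound[of l] by simp
    qed
    moreover have "integral {0..1} (\<lambda>t. norm (vector_derivative (Phi_norm b l) (at t)))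
        \<le> K / \<delta> * X l powr (2 / 3 - \<delta>)" for l
    proof -
      have "real l * X l powr (1 - alpha b) \<le> 1 / \<delta> * X l powr \<delta> * X l powr (1 - alpha b)"
        using nat_le_powr[OF assms \<delta>(1), of l] by (intro mult_right_mono) (auto simp: X_def)
      also have "\<dots> = 1 / \<delta> * X l powr (2 / 3 - \<delta>)"
        using \<delta> by (simp flip: powr_add)
      finally have "K * (real l * X l powr (1 - alpha b)) \<le> K * (1 / \<delta> * X l powr (2 / 3 - \<delta>))"
        using K by (intro mult_left_mono) auto
      then show ?thesis using bound'[of l] by simp
    qed
    ultimately show ?thesis
      using \<delta>(1) K by (intro exI[of _ \<delta>] conjI exI[of _ 1] exI[of _ "K / \<delta>"]) auto
  qed
  moreover have "\<exists>C>0. \<forall>l. integral {0..1} (\<lambda>t. norm (Phi_norm b l t)) \<le> C * (1 / X l powr alpha b)"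
    using bound by (intro exI[of _ 1]) auto
  moreover have "\<exists>C>0. \<forall>l. integral {0..1} (\<lambda>t. norm (vector_derivative (Phi_norm b l) (at t)))
      \<le> C * (real l * X l powr (1 - alpha b))"
    using bound' K by blast
  ultimately show ?thesis
    unfolding X_def by meson
qed

end
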